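(* Let the ILRFPP model on $\mathbb{Z}^d$ satisfy the standing assumptions, and suppose $\alpha\gamma>d$ and $\alpha\theta>d$. Fix $x\in\mathbb{R}^d$ with $\|x\|_\infty\le1$, $x\ne0$. Fix $K>0$ and let $\mathcal{P}_n(K)$ be the set of finite self-avoiding paths from $0$ to $\lceil nx\rceil$ of total weight at most $K$. Then there is a constant $a_0>1$ such that for every $\varepsilon>0$ there is $C_{K,\varepsilon}<\infty$ with $$\limsup_{n\to\infty}\mathbb{P}\Big(\exists\,\pi\in\mathcal{P}_n(K)\text{ with }|\pi|\le\frac{\log\log n}{\log a_0}-C_{K,\varepsilon}\Big)\le\varepsilon.$$ In particular, for every $c_K<1/\log a_0$, $$\lim_{n\to\infty}\mathbb{P}\big(\exists\,\pi\in\mathcal{P}_n(K)\text{ with }|\pi|\le c_K\log\log n\big)=0.$$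
   Context: Model (inhomogeneous long-range first-passage percolation, ILRFPP). Fix an integer $d\ge1$ and $\alpha>0$; $\|\cdot\|$ is the $\ell_1$ norm on $\mathbb{Z}^d$. The vertex weights $(V_x)_{x\in\mathbb{Z}^d}$ are i.i.d. with the law of a random variable $V$; the edge noises $\omega_{xy}=\omega_{yx}\ge0$, one for every unordered pair $\{x,y\}$ of distinct vertices of $\mathbb{Z}^d$ (all pairs are edges), are i.i.d. with the law of $\omega$, and independent of the vertex weights. The passage time of an edge is $W_{xy}:=\|x-y\|^{\alpha}\,\omega_{xy}/(V_xV_y)$. A path $\pi$ is a finite sequence of distinct vertices; its total weight $W_\pi$ is the sum of $W$ over its consecutive edges and $|\pi|$ is its number of edges. $\lceil nx\rceil$ is the coordinatewise ceiling. Standing assumptions: for fixed $\gamma,\theta,\zeta>0$, $\mathbb{P}(0<V<\infty)=1$ and $\lim_{x\to\infty}\log\mathbb{P}(V\ge x)/\log x=-\gamma$; $\lim_{x\downarrow0}\log\mathbb{P}(\omega\le x)/\log x=\theta$ and $\mathbb{E}\,\omega^{\zeta}<\infty$. *)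

theory Defs
  imports "HOL-Probability.Probability"
begin

type_synonym 'd vertex = "int ^ 'd"

definition l1_norm :: "'d::finite vertex \<Rightarrow> int" where
  "l1_norm x = (\<Sum>i\<in>UNIV. \<bar>x $ i\<bar>)"

definition edges :: "'d::finite vertex set set" where
  "edges = {{x, y} |x y. x \<noteq> y}"

text \<open>
  Indexing the noise by two-element sets builds in its symmetry. The laws \<open>\<mu>\<close> of \<open>V\<close> and \<open>\<nu>\<close> of
  \<open>\<omega>\<close> are explicit parameters; vertex weights and edge noises form one jointly independent family,
  indexed by the disjoint sum of vertices and edges. Since \<open>ln 0 = 0\<close> in HOL while \<open>\<gamma>, \<theta> > 0\<close>,
  the two logarithmic limits force the probabilities involved to be eventually positive, exactly as
  with the convention \<open>log 0 = -\<infinity>\<close>.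
\<close>

locale ilrfpp = prob_space M
  for M :: "'a measure" +
  fixes V :: "'d::finite vertex \<Rightarrow> 'a \<Rightarrow> real"
    and \<omega> :: "'d vertex set \<Rightarrow> 'a \<Rightarrow> real"
    and \<mu> \<nu> :: "real measure"
    and \<alpha> \<gamma> \<theta> \<zeta> :: real
  assumes parameters_pos: "0 < \<alpha>" "0 < \<gamma>" "0 < \<theta>" "0 < \<zeta>"
    and indep: "indep_vars (\<lambda>_. borel) (case_sum V \<omega>) (UNIV <+> edges)"
    and law_V: "\<And>x. distr M borel (V x) = \<mu>"
    and law_\<omega>: "\<And>e. e \<in> edges \<Longrightarrow> distr M borel (\<omega> e) = \<nu>"
    and V_pos: "measure \<mu> {0<..} = 1"
    and V_tail: "((\<lambda>t. ln (measure \<mu> {t..}) / ln t) \<longlongrightarrow> - \<gamma>) at_top"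
    and \<omega>_nonneg: "AE t in \<nu>. 0 \<le> t"
    and \<omega>_near_0: "((\<lambda>t. ln (measure \<nu> {..t}) / ln t) \<longlongrightarrow> \<theta>) (at_right 0)"
    and \<omega>_moment: "integrable \<nu> (\<lambda>t. t powr \<zeta>)"

definition passage_time ::
  "('d::finite vertex \<Rightarrow> 'a \<Rightarrow> real) \<Rightarrow> ('d vertex set \<Rightarrow> 'a \<Rightarrow> real) \<Rightarrow> real
    \<Rightarrow> 'a \<Rightarrow> 'd vertex \<Rightarrow> 'd vertex \<Rightarrow> real" where
  "passage_time V \<omega> \<alpha> w x y =
     real_of_int (l1_norm (x - y)) powr \<alpha> * \<omega> {x, y} w / (V x w * V y w)"

text \<open>A path is the nonempty list of the vertices it visits, so it has one edge fewer than entries.\<close>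

definition is_path :: "'d::finite vertex \<Rightarrow> 'd vertex \<Rightarrow> 'd vertex list \<Rightarrow> bool" where
  "is_path x y \<pi> \<longleftrightarrow> \<pi> \<noteq> [] \<and> distinct \<pi> \<and> hd \<pi> = x \<and> last \<pi> = y"

definition num_edges :: "'d::finite vertex list \<Rightarrow> nat" where
  "num_edges \<pi> = length \<pi> - 1"

definition path_weight ::
  "('d::finite vertex \<Rightarrow> 'a \<Rightarrow> real) \<Rightarrow> ('d vertex set \<Rightarrow> 'a \<Rightarrow> real) \<Rightarrow> real
    \<Rightarrow> 'a \<Rightarrow> 'd vertex list \<Rightarrow> real" where
  "path_weight V \<omega> \<alpha> w \<pi> = (\<Sum>i<num_edges \<pi>. passage_time V \<omega> \<alpha> w (\<pi> ! i) (\<pi> ! Suc i))"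

definition ceiling_vec :: "real ^ 'd \<Rightarrow> 'd::finite vertex" where
  "ceiling_vec x = (\<chi> i. \<lceil>x $ i\<rceil>)"

definition light_paths ::
  "('d::finite vertex \<Rightarrow> 'a \<Rightarrow> real) \<Rightarrow> ('d vertex set \<Rightarrow> 'a \<Rightarrow> real) \<Rightarrow> real
    \<Rightarrow> real ^ 'd \<Rightarrow> nat \<Rightarrow> real \<Rightarrow> 'a \<Rightarrow> 'd vertex list set" where
  "light_paths V \<omega> \<alpha> x n K w =
     {\<pi>. is_path 0 (ceiling_vec (real n *\<^sub>R x)) \<pi> \<and> path_weight V \<omega> \<alpha> w \<pi> \<le> K}"

text \<open>
  The event whose probability the theorem bounds is measurable, so \<open>measure M\<close> is meaningful on it.
\<close>

lemma (in ilrfpp) light_path_event_measurable: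
  "{w \<in> space M. \<exists>\<pi>\<in>light_paths V \<omega> \<alpha> x n K w. real (num_edges \<pi>) \<le> r} \<in> sets M"
proof -
  have V_meas: "V y \<in> borel_measurable M" for y
    using indep unfolding indep_vars_def by (auto dest: bspec[of _ _ "Inl y"])
  have \<omega>_meas: "\<omega> e \<in> borel_measurable M" if "e \<in> edges" for e
    using indep that unfolding indep_vars_def by (auto dest: bspec[of _ _ "Inr e"])
  have weight_meas: "(\<lambda>w. path_weight V \<omega> \<alpha> w \<pi>) \<in> borel_measurable M" if "distinct \<pi>" for \<pi>
    unfolding path_weight_def
  proof (rule borel_measurable_sum)
    fix i assume "i \<in> {..<num_edges \<pi>}"
    then have "\<pi> ! i \<noteq> \<pi> ! Suc i"
      using that by (auto simp: num_edges_def nth_eq_iff_index_eq)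
    then have "{\<pi> ! i, \<pi> ! Suc i} \<in> edges"
      unfolding edges_def by blast
    note [measurable] = V_meas \<omega>_meas[OF this]
    show "(\<lambda>w. passage_time V \<omega> \<alpha> w (\<pi> ! i) (\<pi> ! Suc i)) \<in> borel_measurable M"
      unfolding passage_time_def by measurable
  qed
  define P where "P = {\<pi>. is_path 0 (ceiling_vec (real n *\<^sub>R x)) \<pi> \<and> real (num_edges \<pi>) \<le> r}"
  have "{w \<in> space M. \<exists>\<pi>\<in>light_paths V \<omega> \<alpha> x n K w. real (num_edges \<pi>) \<le> r}
      = (\<Union>\<pi>\<in>P. {w \<in> space M. path_weight V \<omega> \<alpha> w \<pi> \<le> K})"
    unfolding light_paths_def P_def by blast
  also have "\<dots> \<in> sets M"
  proof (rule sets.countable_UN)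
    have "{w \<in> space M. path_weight V \<omega> \<alpha> w \<pi> \<le> K} \<in> sets M" if "\<pi> \<in> P" for \<pi>
    proof -
      have [measurable]: "(\<lambda>w. path_weight V \<omega> \<alpha> w \<pi>) \<in> borel_measurable M"
        using weight_meas that unfolding P_def is_path_def by blast
      show ?thesis by measurable
    qed
    then show "(\<lambda>\<pi>. {w \<in> space M. path_weight V \<omega> \<alpha> w \<pi> \<le> K}) ` P \<subseteq> sets M" by blast
  qed
  finally show ?thesis .
qed

end

theory Submission
  imports Defs
begin

text \<open>
  A path of total weight at most \<open>K\<close> uses only edges of passage time at most \<open>K\<close>, because passage
  times are almost surely nonnegative. So it suffices to show that the graph of these light edges
  cannot be crossed quickly, and for this it is enough that a light edge starting at distance \<open>r\<close>
  from the origin never ends beyond distance about \<open>r powr A\<close>, for a large fixed exponent \<open>A\<close>.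

  The probability that an edge of length \<open>r\<close> is light decays polynomially. Choose \<open>p\<close> with
  \<open>d / \<alpha> < p < min \<gamma> \<theta>\<close>, which is possible exactly because \<open>\<alpha>\<gamma> > d\<close> and \<open>\<alpha>\<theta> > d\<close>. The tail
  assumptions make the moments \<open>E[V^p]\<close> and \<open>E[\<omega>^{-p}]\<close> finite, and since the edge is light only if
  \<open>K r^{-\<alpha>} V_y V_z / \<omega>_{yz} \<ge> 1\<close>, Markov's inequality and independence give a bound of order
  \<open>r^{-\<beta>}\<close> with \<open>\<beta> = \<alpha> p > d\<close> (lemma \<open>prob_light_edge_le\<close>).

  Fix \<open>\<beta>'\<close> between \<open>d\<close> and \<open>\<beta>\<close>. Call an edge from \<open>y\<close> to \<open>z\<close> a jump if
  \<open>\<parallel>z\<parallel> > (max R \<parallel>y\<parallel>) powr A\<close>. Its length is comparable to \<open>\<parallel>z\<parallel>\<close>, so \<open>\<parallel>y - z\<parallel>^{-\<beta>}\<close> is at most a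
  constant times \<open>\<parallel>z\<parallel>^{-\<beta>'} \<parallel>z\<parallel>^{-(\<beta> - \<beta>')}\<close>; the second factor is at most
  \<open>(max R \<parallel>y\<parallel>)^{-A (\<beta> - \<beta>')}\<close>, and for \<open>A\<close> large this is at most \<open>R^{-1}\<close> times a
  constant multiple of \<open>(1 + \<parallel>y\<parallel>)^{-\<beta>'}\<close>. Both variables are now summable over the lattice, so a
  union bound shows that some jump is light with probability \<open>O(1 / R)\<close> (lemma
  \<open>light_jump_event_unlikely\<close>).

  If no jump is light, the first \<open>k\<close> edges of a light path from the origin stay within distance
  \<open>R powr (A ^ k)\<close> (lemma \<open>light_path_confined\<close>). Reaching distance of order \<open>n\<close> therefore takes at
  least \<open>ln (ln n) / ln A - C\<close> edges, where \<open>C\<close> depends on \<open>R\<close>, hence on \<open>\<epsilon>\<close>, but \<open>A\<close> does not.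
  So \<open>a\<^sub>0 = A\<close> works.
\<close>

section \<open>Moments from tail bounds, and a countable union bound\<close>

text \<open>
  On the dyadic layer where \<open>X\<close> lies between \<open>2 ^ i\<close> and \<open>2 ^ (i + 1)\<close>, the integrand is of order
  \<open>2 ^ (i p)\<close> and the probability of order \<open>2 ^ (- i q)\<close>, so the layers contribute a geometric
  series with ratio \<open>2 powr (p - q) < 1\<close>. The layers start at a power of two beyond which the tail
  bound holds.
\<close>

lemma nn_integral_powr_finite_if_tail_bound:
  fixes X :: "'a \<Rightarrow> real"
  assumes "prob_space N" and [measurable]: "X \<in> borel_measurable N" and nonneg: "AE u in N. 0 \<le> X u"
    and p: "0 < p" "p < q"
    and tail: "\<forall>\<^sub>F t in at_top. measure N {u \<in> space N. t \<le> X u} \<le> t powr - q"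
  shows "(\<integral>\<^sup>+u. ennreal (X u powr p) \<partial>N) < \<infinity>"
proof -
  interpret prob_space N by fact
  obtain T where T: "\<And>t. t \<ge> T \<Longrightarrow> measure N {u \<in> space N. t \<le> X u} \<le> t powr - q"
    using tail unfolding eventually_at_top_linorder by blast
  obtain k :: nat where k: "T < 2 ^ k"
    using real_arch_pow[of 2 T] by auto
  define b :: "nat \<Rightarrow> real" where "b i = 2 ^ (i + k)" for i
  have b_pos: "b i > 0" and b_ge: "b i \<ge> T" and b_Suc: "b (Suc i) = 2 * b i" for i
  proof -
    have "(2::real) ^ k \<le> 2 ^ (i + k)" by (intro power_increasing) auto
    then show "b i \<ge> T" using k unfolding b_def by linarith
  qed (auto simp: b_def)
  define F where "F i u = ennreal (b (Suc i) powr p) * indicator {u \<in> space N. b i \<le> X u} u" for i u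
  have pointwise: "ennreal (X u powr p) \<le> ennreal (b 0 powr p) + (\<Sum>i. F i u)"
    if u: "u \<in> space N" "0 \<le> X u" for u
  proof (cases "X u < b 0")
    case True
    then have "X u powr p \<le> b 0 powr p" using u p by (intro powr_mono2) auto
    then show ?thesis by (simp add: add_increasing2 ennreal_leI)
  next
    case False
    define m where "m = (LEAST m. X u < b m)"
    obtain m0 :: nat where "X u < 2 ^ m0" using real_arch_pow[of 2 "X u"] by auto
    moreover have "(2::real) ^ m0 \<le> 2 ^ (m0 + k)" by (intro power_increasing) auto
    ultimately have "X u < b m0" unfolding b_def by linarith
    then have m: "X u < b m" unfolding m_def by (rule LeastI)
    then obtain i where i: "m = Suc i" using False by (cases m) auto
    then have "\<not> X u < b i" unfolding m_def by (metis not_less_Least lessI)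
    then have "F i u = ennreal (b m powr p)" using u by (simp add: F_def i)
    moreover have "X u powr p \<le> b m powr p" using u p m by (intro powr_mono2) auto
    ultimately have "ennreal (X u powr p) \<le> F i u" by (simp add: ennreal_leI)
    also have "\<dots> \<le> (\<Sum>i. F i u)"
      using sum_le_suminf[of "\<lambda>i. F i u" "{i}"] by simp
    finally show ?thesis by (simp add: add_increasing)
  qed
  have [measurable]: "F i \<in> borel_measurable N" for i unfolding F_def by measurable
  define r where "r = 2 powr (p - q)"
  have r: "0 < r" "r < 1"
    using p powr_less_mono[of "p - q" 0 2] by (auto simp: r_def)
  have integral_F: "(\<integral>\<^sup>+u. F i u \<partial>N) \<le> ennreal (2 powr p * b 0 powr (p - q) * r ^ i)" for i
  proof -
    have "(\<integral>\<^sup>+u. F i u \<partial>N) = ennreal (b (Suc i) powr p) * emeasure N {u \<in> space N. b i \<le> X u}"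
      unfolding F_def by (subst nn_integral_cmult_indicator) auto
    also have "\<dots> = ennreal (b (Suc i) powr p * measure N {u \<in> space N. b i \<le> X u})"
      by (simp add: emeasure_eq_measure ennreal_mult)
    also have "\<dots> \<le> ennreal (b (Suc i) powr p * b i powr - q)"
      by (intro ennreal_leI mult_left_mono T b_ge) auto
    also have "b (Suc i) powr p * b i powr - q = 2 powr p * b i powr (p - q)"
      using b_pos[of i] by (simp add: b_Suc powr_mult powr_diff powr_minus divide_inverse)
    also have "b i = 2 ^ i * b 0" by (simp add: b_def power_add)
    also have "(2 ^ i * b 0) powr (p - q) = b 0 powr (p - q) * r ^ i"
      using b_pos[of 0] by (simp add: powr_mult r_def powr_realpow[symmetric] powr_powr mult.commute)
    finally show ?thesis by (simp add: mult.assoc)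
  qed
  have "(\<integral>\<^sup>+u. ennreal (X u powr p) \<partial>N) \<le> (\<integral>\<^sup>+u. ennreal (b 0 powr p) + (\<Sum>i. F i u) \<partial>N)"
    using AE_space nonneg by (intro nn_integral_mono_AE; eventually_elim) (rule pointwise)
  also have "\<dots> = ennreal (b 0 powr p) + (\<Sum>i. \<integral>\<^sup>+u. F i u \<partial>N)"
    by (simp add: nn_integral_add nn_integral_suminf emeasure_space_1)
  also have "\<dots> \<le> ennreal (b 0 powr p) + (\<Sum>i. ennreal (2 powr p * b 0 powr (p - q) * r ^ i))"
    by (intro add_left_mono suminf_le integral_F) auto
  also have "\<dots> < \<infinity>"
    using r by (subst suminf_ennreal2) (auto intro!: summable_mult summable_geometric)
  finally show ?thesis .
qed

lemma emeasure_UN_le_nn_integral_count_space: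
  fixes A :: "'i::countable \<Rightarrow> 'a set"
  assumes "\<And>i. A i \<in> sets M"
  shows "emeasure M (\<Union>i. A i) \<le> (\<integral>\<^sup>+i. emeasure M (A i) \<partial>count_space UNIV)"
proof -
  let ?B = "\<lambda>n. if n \<in> range (to_nat :: 'i \<Rightarrow> nat) then A (from_nat n) else {}"
  have "(\<Union>i. A i) = (\<Union>n. ?B n)"
    by (force split: if_splits)
  also have "emeasure M \<dots> \<le> (\<Sum>n. emeasure M (?B n))"
    using assms by (intro emeasure_subadditive_countably) auto
  also have "\<dots> = (\<integral>\<^sup>+n. emeasure M (?B n) \<partial>count_space UNIV)"
    by (simp add: nn_integral_count_space_nat)
  also have "\<dots> = (\<integral>\<^sup>+n. emeasure M (A (from_nat n)) \<partial>count_space (range (to_nat :: 'i \<Rightarrow> nat)))"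
    by (subst nn_integral_count_space_indicator) (auto intro!: nn_integral_cong split: split_indicator)
  also have "\<dots> = (\<integral>\<^sup>+i. emeasure M (A i) \<partial>count_space UNIV)"
    by (subst nn_integral_bij_count_space[where g = to_nat and A = UNIV, symmetric])
       (auto simp: bij_betw_def)
  finally show ?thesis .
qed

section \<open>Summability over the lattice\<close>

lemma l1_norm_nonneg: "0 \<le> l1_norm x"
  by (simp add: l1_norm_def sum_nonneg)

lemma abs_component_le_l1_norm: "\<bar>y $ i\<bar> \<le> l1_norm y"
  unfolding l1_norm_def by (rule member_le_sum) auto

lemma l1_norm_pos: "y \<noteq> 0 \<Longrightarrow> 0 < l1_norm y"
proof -
  assume "y \<noteq> 0"
  then obtain i where "y $ i \<noteq> 0" by (auto simp: vec_eq_iff)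
  then show ?thesis using abs_component_le_l1_norm[of y i] by linarith
qed

lemma l1_norm_triangle_diff: "l1_norm z \<le> l1_norm (y - z) + l1_norm y"
  unfolding l1_norm_def by (subst sum.distrib[symmetric], rule sum_mono) auto

text \<open>
  Enumerating the integers as \<open>0, -1, 1, -2, \<dots>\<close>, the \<open>n\<close>-th one has absolute value about \<open>n / 2\<close>,
  so the claim reduces to the convergence of \<open>\<Sum>n. n powr - s\<close>.
\<close>

lemma integrable_count_space_int_powr:
  assumes "s > (1::real)"
  shows "integrable (count_space (UNIV :: int set)) (\<lambda>j. (1 + real_of_int \<bar>j\<bar>) powr - s)"
proof -
  have "summable (\<lambda>n. real n powr - s)" using assms by (simp add: summable_real_powr_iff)
  then have "summable (\<lambda>n. 2 powr s * real (Suc n) powr - s)"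
    by (intro summable_mult) (subst summable_Suc_iff)
  moreover have "norm (norm ((1 + real_of_int \<bar>int_decode n\<bar>) powr - s)) \<le> 2 powr s * real (Suc n) powr - s" for n
  proof -
    have "real (Suc n) / 2 \<le> 1 + real_of_int \<bar>int_decode n\<bar>"
      unfolding int_decode_def sum_decode_def by (auto elim!: oddE)
    then have "(1 + real_of_int \<bar>int_decode n\<bar>) powr - s \<le> (real (Suc n) / 2) powr - s"
      using assms by (intro powr_mono2') auto
    then show ?thesis by (simp add: powr_divide powr_minus_divide)
  qed
  ultimately have "summable (\<lambda>n. norm ((1 + real_of_int \<bar>int_decode n\<bar>) powr - s))"
    by (rule summable_comparison_test'[where N = 0])
  then have "Infinite_Set_Sum.abs_summable_on (\<lambda>n. (1 + real_of_int \<bar>int_decode n\<bar>) powr - s) UNIV"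
    by (simp only: abs_summable_on_nat_iff')
  then show ?thesis
    using abs_summable_on_reindex_bij_betw
      [OF bij_int_decode, of "\<lambda>j. (1 + real_of_int \<bar>j\<bar>) powr - s"]
    by (simp add: abs_summable_on_def)
qed

text \<open>
  Since \<open>1 + \<bar>z\<^sub>i\<bar> \<le> 1 + \<parallel>z\<parallel>\<close> for each of the \<open>d\<close> coordinates, \<open>(1 + \<parallel>z\<parallel>) powr - \<beta>\<close> is at most the
  product over \<open>i\<close> of \<open>(1 + \<bar>z\<^sub>i\<bar>) powr - (\<beta> / d)\<close>. The sum over the lattice thus factors into \<open>d\<close>
  one-dimensional sums, which converge because \<open>\<beta> / d > 1\<close>.
\<close>

lemma nn_integral_l1_norm_powr_finite:
  assumes "\<beta> > real CARD('d::finite)"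
  shows "(\<integral>\<^sup>+z. ennreal ((1 + real_of_int (l1_norm (z :: 'd vertex))) powr - \<beta>) \<partial>count_space UNIV) < \<infinity>"
proof -
  define d where "d = real CARD('d)"
  have d: "d > 0" "\<beta> / d > 1" using assms by (auto simp: d_def)
  let ?f = "\<lambda>j::int. (1 + real_of_int \<bar>j\<bar>) powr - (\<beta> / d)"
  have "Infinite_Set_Sum.abs_summable_on (\<lambda>h. \<Prod>i\<in>(UNIV :: 'd set). ?f (h i)) (Pi\<^sub>E UNIV (\<lambda>_. UNIV))"
    using integrable_count_space_int_powr[OF d(2)]
    by (intro abs_summable_on_prod_PiE) (auto simp: abs_summable_on_def)
  moreover have "bij_betw ((\<lambda>z i. z $ i) :: 'd vertex \<Rightarrow> _) UNIV (Pi\<^sub>E UNIV (\<lambda>_. UNIV))"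
    by (rule bij_betwI[where g = "\<lambda>h. \<chi> i. h i"]) auto
  ultimately have "Infinite_Set_Sum.abs_summable_on (\<lambda>z :: 'd vertex. \<Prod>i\<in>UNIV. ?f (z $ i)) UNIV"
    using abs_summable_on_reindex_bij_betw
      [of "(\<lambda>z i. z $ i) :: 'd vertex \<Rightarrow> _" UNIV "Pi\<^sub>E UNIV (\<lambda>_. UNIV)" "\<lambda>h. \<Prod>i\<in>UNIV. ?f (h i)"]
    by simp
  moreover have "norm ((1 + real_of_int (l1_norm z)) powr - \<beta>) \<le> (\<Prod>i\<in>UNIV. ?f (z $ i))"
    for z :: "'d vertex"
  proof -
    have "(1 + real_of_int (l1_norm z)) powr - \<beta> = (\<Prod>i\<in>(UNIV :: 'd set). (1 + real_of_int (l1_norm z)) powr - (\<beta> / d))"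
      using l1_norm_nonneg[of z] d by (simp add: d_def powr_power)
    also have "\<dots> \<le> (\<Prod>i\<in>UNIV. ?f (z $ i))"
    proof (intro prod_mono conjI powr_mono2')
      fix i :: 'd
      show "1 + real_of_int \<bar>z $ i\<bar> \<le> 1 + real_of_int (l1_norm z)"
        using abs_component_le_l1_norm[of z i] by simp
    qed (use d in auto)
    finally show ?thesis by simp
  qed
  ultimately have "integrable (count_space UNIV) (\<lambda>z :: 'd vertex. (1 + real_of_int (l1_norm z)) powr - \<beta>)"
    unfolding abs_summable_on_def[symmetric] by (rule abs_summable_on_comparison_test')
  then show ?thesis by (simp add: integrable_iff_bounded)
qed

section \<open>Probability of a light edge\<close>

context ilrfpp
begin

lemma V_measurable [measurable]: "V y \<in> borel_measurable M"
  using indep unfolding indep_vars_def by (auto dest: bspec[of _ _ "Inl y"])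

lemma \<omega>_measurable: "e \<in> edges \<Longrightarrow> \<omega> e \<in> borel_measurable M"
  using indep unfolding indep_vars_def by (auto dest: bspec[of _ _ "Inr e"])

lemma edge_in_edges: "y \<noteq> z \<Longrightarrow> {y, z} \<in> edges"
  unfolding edges_def by blast

lemma edges_nonempty: "(edges :: 'd vertex set set) \<noteq> {}"
  using edge_in_edges[of "0 :: 'd vertex" 1] by (auto simp: vec_eq_iff)

lemma prob_space_\<mu>: "prob_space \<mu>" and sets_\<mu> [measurable_cong]: "sets \<mu> = sets borel"
  using prob_space_distr[OF V_measurable] law_V[of 0] sets_distr[of M borel] by metis+

lemma prob_space_\<nu>: "prob_space \<nu>" and sets_\<nu> [measurable_cong]: "sets \<nu> = sets borel"
  using prob_space_distr[OF \<omega>_measurable] law_\<omega> edges_nonempty sets_distr[of M borel]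
  by (metis all_not_in_conv)+

lemma V_tail_bound:
  assumes "q < \<gamma>"
  shows "\<forall>\<^sub>F t in at_top. measure \<mu> {t..} \<le> t powr - q"
proof -
  have "\<forall>\<^sub>F t in at_top. ln (measure \<mu> {t..}) / ln t < - q"
    using V_tail assms by (intro order_tendstoD) auto
  then show ?thesis
    using eventually_gt_at_top[of 1]
  proof eventually_elim
    case (elim t)
    show ?case
    proof (cases "measure \<mu> {t..} = 0")
      case False
      have "ln (measure \<mu> {t..}) \<le> ln (t powr - q)"
        using elim by (simp add: ln_powr divide_less_eq)
      then show ?thesis
        using False elim by (subst (asm) ln_le_cancel_iff) (auto simp: zero_less_measure_iff)
    qed simp
  qed
qed

lemma \<omega>_lower_tail_bound:
  assumes "q < \<theta>"
  shows "\<forall>\<^sub>F t in at_right 0. measure \<nu> {..t} \<le> t powr q"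
proof -
  have "\<forall>\<^sub>F t in at_right 0. q < ln (measure \<nu> {..t}) / ln t"
    using \<omega>_near_0 assms by (intro order_tendstoD) auto
  moreover have "\<forall>\<^sub>F t in at_right 0. t \<in> {0<..<1::real}"
    by (rule eventually_at_right_real) simp
  ultimately show ?thesis
  proof eventually_elim
    case (elim t)
    then have t: "0 < t" "ln t < 0" by auto
    show ?case
    proof (cases "measure \<nu> {..t} = 0")
      case False
      have "ln (measure \<nu> {..t}) \<le> ln (t powr q)"
        using elim t by (simp add: ln_powr less_divide_eq)
      then show ?thesis
        using False t by (subst (asm) ln_le_cancel_iff) (auto simp: zero_less_measure_iff)
    qed simp
  qed
qed

lemma AE_\<mu>_pos: "AE v in \<mu>. 0 < v"
proof -
  interpret \<mu>: prob_space \<mu> by (rule prob_space_\<mu>)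
  show ?thesis using \<mu>.AE_prob_1[OF V_pos] by simp
qed

text \<open>
  The behaviour of \<open>\<nu>\<close> near \<open>0\<close> excludes an atom at \<open>0\<close>: the mass of \<open>{..0}\<close> is at most
  \<open>t powr (\<theta> / 2)\<close> for all small \<open>t > 0\<close>. This lets the argument divide by \<open>\<omega>\<close>, whose inverse at \<open>0\<close>
  would be \<open>0\<close> instead of infinite.
\<close>

lemma AE_\<nu>_pos: "AE t in \<nu>. 0 < t"
proof -
  interpret \<nu>: prob_space \<nu> by (rule prob_space_\<nu>)
  have "((\<lambda>t::real. t powr (\<theta> / 2)) \<longlongrightarrow> 0) (at_right 0)"
    using parameters_pos by real_asymp
  moreover have "\<forall>\<^sub>F t in at_right 0. measure \<nu> {..0} \<le> t powr (\<theta> / 2)"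
  proof -
    have "\<forall>\<^sub>F t in at_right 0. measure \<nu> {..t} \<le> t powr (\<theta> / 2)"
      using parameters_pos by (intro \<omega>_lower_tail_bound) simp
    then show ?thesis
      using eventually_at_right_less[of 0]
    proof eventually_elim
      case (elim t)
      then have "measure \<nu> {..0} \<le> measure \<nu> {..t}" by (intro \<nu>.finite_measure_mono) auto
      with elim show ?case by linarith
    qed
  qed
  ultimately have "measure \<nu> {..0} \<le> 0"
    by (rule tendsto_lowerbound) simp
  then have "measure \<nu> {..0} = 0" using measure_nonneg[of \<nu> "{..0}"] by linarith
  then have "{..0} \<in> null_sets \<nu>" by (auto simp: null_sets_def \<nu>.emeasure_eq_measure)
  then have "AE t in \<nu>. t \<notin> {..0}" by (rule AE_not_in)
  then show ?thesis by eventually_elim auto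
qed

lemma AE_V_pos: "AE w in M. 0 < V y w"
proof -
  have "AE v in distr M borel (V y). 0 < v" using AE_\<mu>_pos unfolding law_V .
  then show ?thesis by (simp add: AE_distr_iff)
qed

lemma AE_\<omega>_pos: "e \<in> edges \<Longrightarrow> AE w in M. 0 < \<omega> e w"
proof -
  assume e: "e \<in> edges"
  have "AE v in distr M borel (\<omega> e). 0 < v" using AE_\<nu>_pos unfolding law_\<omega>[OF e] .
  then show ?thesis using e by (simp add: AE_distr_iff \<omega>_measurable)
qed

lemma AE_all_weights_pos: "AE w in M. (\<forall>y. 0 < V y w) \<and> (\<forall>y z. y \<noteq> z \<longrightarrow> 0 < \<omega> {y, z} w)"
  using AE_V_pos AE_\<omega>_pos[OF edge_in_edges] by (auto simp: AE_all_countable)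

lemma V_moment_finite:
  assumes "0 < p" "p < \<gamma>"
  shows "(\<integral>\<^sup>+v. ennreal (v powr p) \<partial>\<mu>) < \<infinity>"
proof -
  define q where "q = (p + \<gamma>) / 2"
  have "\<forall>\<^sub>F t in at_top. measure \<mu> {u \<in> space \<mu>. t \<le> u} \<le> t powr - q"
    using V_tail_bound[of q] assms sets_eq_imp_space_eq[OF sets_\<mu>]
    by (simp add: q_def atLeast_def)
  moreover have "AE v in \<mu>. 0 \<le> v" using AE_\<mu>_pos by eventually_elim auto
  ultimately show ?thesis
    using assms by (intro nn_integral_powr_finite_if_tail_bound[OF prob_space_\<mu>]) (auto simp: q_def)
qed

text \<open>
  The lower tail of \<open>\<omega>\<close> at \<open>0\<close> is the upper tail of its inverse at infinity.
\<close>

lemma \<omega>_inverse_moment_finite: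
  assumes "0 < p" "p < \<theta>"
  shows "(\<integral>\<^sup>+t. ennreal (inverse t powr p) \<partial>\<nu>) < \<infinity>"
proof -
  interpret \<nu>: prob_space \<nu> by (rule prob_space_\<nu>)
  define q where "q = (p + \<theta>) / 2"
  have "\<forall>\<^sub>F t in at_right 0. measure \<nu> {..t} \<le> t powr q"
    using assms by (intro \<omega>_lower_tail_bound) (simp add: q_def)
  then have "\<forall>\<^sub>F t in at_top. measure \<nu> {..inverse t} \<le> inverse t powr q"
    by (simp add: eventually_at_right_to_top)
  then have "\<forall>\<^sub>F t in at_top. measure \<nu> {u \<in> space \<nu>. t \<le> inverse u} \<le> t powr - q"
    using eventually_gt_at_top[of 0]
  proof eventually_elim
    case (elim t)
    have "u \<le> inverse t" if "t \<le> inverse u" for u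
    proof -
      have "0 < u" using that elim by (metis inverse_positive_iff_positive less_le_trans)
      then show ?thesis using that elim by (simp add: field_simps)
    qed
    then have "measure \<nu> {u \<in> space \<nu>. t \<le> inverse u} \<le> measure \<nu> {..inverse t}"
      by (intro \<nu>.finite_measure_mono) auto
    also have "\<dots> \<le> t powr - q"
      using elim by (simp add: powr_minus inverse_powr)
    finally show ?case .
  qed
  moreover have "AE v in \<nu>. 0 \<le> inverse v" using AE_\<nu>_pos by eventually_elim auto
  ultimately show ?thesis
    using assms by (intro nn_integral_powr_finite_if_tail_bound[OF prob_space_\<nu>]) (auto simp: q_def)
qed

lemma passage_time_measurable:
  assumes "y \<noteq> z"
  shows "(\<lambda>w. passage_time V \<omega> \<alpha> w y z) \<in> borel_measurable M"
proof -
  note [measurable] = \<omega>_measurable[OF edge_in_edges[OF assms]]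
  show ?thesis unfolding passage_time_def by measurable
qed

lemma nn_integral_edge_factors:
  assumes "y \<noteq> z"
  shows "(\<integral>\<^sup>+w. ennreal (V y w powr p) * ennreal (V z w powr p) * ennreal (inverse (\<omega> {y, z} w) powr p) \<partial>M)
    = (\<integral>\<^sup>+v. ennreal (v powr p) \<partial>\<mu>) ^ 2 * (\<integral>\<^sup>+t. ennreal (inverse t powr p) \<partial>\<nu>)"
proof -
  define I where "I = {Inl y, Inl z, Inr {y, z} :: 'd vertex + 'd vertex set}"
  define h :: "'d vertex + 'd vertex set \<Rightarrow> real \<Rightarrow> ennreal"
    where "h i t = (case i of Inl _ \<Rightarrow> ennreal (t powr p) | Inr _ \<Rightarrow> ennreal (inverse t powr p))" for i t
  have [measurable]: "h i \<in> borel_measurable borel" for i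
    unfolding h_def by (cases i) auto
  have "indep_vars (\<lambda>_. borel) (case_sum V \<omega>) I"
    using edge_in_edges[OF assms] by (intro indep_vars_subset[OF indep]) (auto simp: I_def)
  then have "indep_vars (\<lambda>_. borel) (\<lambda>i w. h i (case_sum V \<omega> i w)) I"
    by (rule indep_vars_compose2) auto
  then have "(\<integral>\<^sup>+w. (\<Prod>i\<in>I. h i (case_sum V \<omega> i w)) \<partial>M) = (\<Prod>i\<in>I. \<integral>\<^sup>+w. h i (case_sum V \<omega> i w) \<partial>M)"
    by (intro indep_vars_nn_integral) (auto simp: I_def)
  moreover have "(\<integral>\<^sup>+w. ennreal (V x w powr p) \<partial>M) = (\<integral>\<^sup>+v. ennreal (v powr p) \<partial>\<mu>)" for x
    by (subst law_V[of x, symmetric], subst nn_integral_distr) auto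
  moreover have "(\<integral>\<^sup>+w. ennreal (inverse (\<omega> {y, z} w) powr p) \<partial>M) = (\<integral>\<^sup>+t. ennreal (inverse t powr p) \<partial>\<nu>)"
    using \<omega>_measurable[OF edge_in_edges[OF assms]]
    by (subst law_\<omega>[OF edge_in_edges[OF assms], symmetric], subst nn_integral_distr) auto
  ultimately show ?thesis
    using assms by (simp add: I_def h_def power2_eq_square mult.assoc)
qed

text \<open>
  Markov's inequality for the \<open>p\<close>-th power of \<open>K r^{-\<alpha>} V_y V_z / \<omega>_{yz}\<close>, which is at least \<open>1\<close> if
  the edge is light. Independence makes its expectation a product of the finite moments above, the
  same for all edges; only the deterministic factor depends on the length \<open>r\<close>.
\<close>

lemma prob_light_edge_le:
  assumes p: "0 < p" "p < \<gamma>" "p < \<theta>" and "K > 0"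
  obtains B where "0 \<le> B"
    and "\<And>y z. y \<noteq> z \<Longrightarrow>
      emeasure M {w \<in> space M. passage_time V \<omega> \<alpha> w y z \<le> K}
        \<le> ennreal (B * real_of_int (l1_norm (y - z)) powr - (\<alpha> * p))"
proof -
  define E where "E = (\<integral>\<^sup>+v. ennreal (v powr p) \<partial>\<mu>) ^ 2 * (\<integral>\<^sup>+t. ennreal (inverse t powr p) \<partial>\<nu>)"
  have "E < \<infinity>"
    using V_moment_finite[of p] \<omega>_inverse_moment_finite[of p] p
    by (auto simp: E_def ennreal_mult_less_top power_less_top_ennreal)
  then obtain b where b: "0 \<le> b" "E = ennreal b" by (cases E) auto
  show thesis
  proof
    show "0 \<le> K powr p * b" using b by simp
  next
    fix y z :: "'d vertex" assume yz: "y \<noteq> z"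
    note [measurable] = \<omega>_measurable[OF edge_in_edges[OF yz]] passage_time_measurable[OF yz]
    define r where "r = real_of_int (l1_norm (y - z))"
    have r: "r > 0" using l1_norm_pos[of "y - z"] yz by (simp add: r_def)
    define c where "c = (K * r powr - \<alpha>) powr p"
    let ?G = "\<lambda>w. ennreal (V y w powr p) * ennreal (V z w powr p) * ennreal (inverse (\<omega> {y, z} w) powr p)"
    have "emeasure M {w \<in> space M. passage_time V \<omega> \<alpha> w y z \<le> K}
        = (\<integral>\<^sup>+w. indicator {w \<in> space M. passage_time V \<omega> \<alpha> w y z \<le> K} w \<partial>M)"
      by (rule nn_integral_indicator[symmetric]) simp
    also have "\<dots> \<le> (\<integral>\<^sup>+w. ennreal c * ?G w \<partial>M)"
      using AE_all_weights_pos
    proof (intro nn_integral_mono_AE, eventually_elim)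
      case (elim w)
      then have pos: "0 < V y w" "0 < V z w" "0 < \<omega> {y, z} w" using yz by auto
      show ?case
      proof (cases "passage_time V \<omega> \<alpha> w y z \<le> K")
        case True
        then have "1 \<le> K * r powr - \<alpha> * (V y w * V z w * inverse (\<omega> {y, z} w))"
          using pos r by (simp add: passage_time_def r_def[symmetric] powr_minus field_simps)
        then have "1 powr p \<le> (K * r powr - \<alpha> * (V y w * V z w * inverse (\<omega> {y, z} w))) powr p"
          using p by (intro powr_mono2) auto
        also have "\<dots> = c * (V y w powr p * V z w powr p * inverse (\<omega> {y, z} w) powr p)"
          using pos \<open>K > 0\<close> by (simp add: c_def powr_mult)
        finally have "ennreal 1 \<le> ennreal (c * (V y w powr p * V z w powr p * inverse (\<omega> {y, z} w) powr p))"
          by (intro ennreal_leI) simp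
        then have "1 \<le> ennreal c * ?G w"
          by (simp add: ennreal_mult c_def)
        then show ?thesis by (simp split: split_indicator)
      qed simp
    qed
    also have "\<dots> = ennreal c * E"
      by (simp add: nn_integral_cmult nn_integral_edge_factors[OF yz] E_def)
    also have "\<dots> = ennreal (K powr p * b * r powr - (\<alpha> * p))"
      using b \<open>K > 0\<close> by (simp add: ennreal_mult[symmetric] c_def powr_mult powr_powr mult_ac)
    finally show "emeasure M {w \<in> space M. passage_time V \<omega> \<alpha> w y z \<le> K}
        \<le> ennreal (K powr p * b * real_of_int (l1_norm (y - z)) powr - (\<alpha> * p))"
      by (simp add: r_def)
  qed
qed

end

section \<open>Light edges that jump far are unlikely\<close>

text \<open>
  The deterministic estimate behind the union bound: the probability bound for an edge from \<open>y\<close> to a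
  much more distant vertex \<open>z\<close> splits into a summable function of \<open>y\<close>, a summable function of \<open>z\<close> and
  a factor \<open>1 / R\<close>. Of the exponent \<open>\<beta>\<close>, the part \<open>\<beta>'\<close> is spent on summing over \<open>z\<close>; the rest, raised
  by the factor \<open>A\<close> because \<open>\<parallel>z\<parallel> > (max R \<parallel>y\<parallel>) powr A\<close>, pays for summing over \<open>y\<close> and for \<open>1 / R\<close>.
\<close>

lemma distance_powr_le_product:
  fixes y z :: "'d::finite vertex" and A R \<beta> \<beta>' :: real
  assumes exps: "0 < \<beta>'" "\<beta>' < \<beta>" and A: "2 \<le> A" "\<beta>' + 1 \<le> A * (\<beta> - \<beta>')" and R: "2 \<le> R"
    and long: "max R (l1_norm y) powr A < l1_norm z"
  shows "y \<noteq> z"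
    and "real_of_int (l1_norm (y - z)) powr - \<beta>
      \<le> 4 powr \<beta> * 2 powr \<beta>' / R * ((1 + real_of_int (l1_norm y)) powr - \<beta>' * (1 + real_of_int (l1_norm z)) powr - \<beta>')"
proof -
  define m a b where "m = max R (real_of_int (l1_norm y))"
    and "a = real_of_int (l1_norm y)" and "b = real_of_int (l1_norm z)"
  have a: "0 \<le> a" by (simp add: a_def l1_norm_nonneg)
  have m: "2 \<le> m" "R \<le> m" "a \<le> m" "(1 + a) / 2 \<le> m" using R by (auto simp: m_def a_def)
  have "2 * m \<le> m ^ 2" using m by (simp add: power2_eq_square)
  also have "\<dots> = m powr 2" using m by (simp add: powr_numeral)
  also have "\<dots> \<le> m powr A" using m A by (intro powr_mono) auto
  also have mb: "m powr A < b" using long by (simp add: m_def b_def)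
  finally have b: "2 * m < b" .
  show "y \<noteq> z" using b m a by (auto simp: a_def b_def)
  have "b \<le> real_of_int (l1_norm (y - z)) + a"
    using l1_norm_triangle_diff[of z y] by (simp add: a_def b_def)
  moreover have "a \<le> b / 2" "1 \<le> b / 2" using b m by simp_all
  ultimately have "(1 + b) / 4 \<le> real_of_int (l1_norm (y - z))" by argo
  then have "real_of_int (l1_norm (y - z)) powr - \<beta> \<le> ((1 + b) / 4) powr - \<beta>"
    using b m exps by (intro powr_mono2') auto
  also have "\<dots> = 4 powr \<beta> * ((1 + b) powr - (\<beta> - \<beta>') * (1 + b) powr - \<beta>')"
    using b m by (simp add: powr_divide powr_minus_divide powr_add[symmetric] divide_simps)
  \<comment> \<open>The surplus exponent becomes decay in \<open>y\<close>, with one power of \<open>m\<close> left over to give \<open>1 / R\<close>.\<close>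
  also have "(1 + b) powr - (\<beta> - \<beta>') \<le> 2 powr \<beta>' / R * (1 + a) powr - \<beta>'"
  proof -
    have "(1 + b) powr - (\<beta> - \<beta>') \<le> (m powr A) powr - (\<beta> - \<beta>')"
      using mb m exps by (intro powr_mono2') auto
    also have "\<dots> = m powr - (A * (\<beta> - \<beta>'))" by (simp add: powr_powr algebra_simps)
    also have "\<dots> \<le> m powr - (\<beta>' + 1)" using A m by (intro powr_mono) auto
    also have "\<dots> = m powr - \<beta>' / m" using m by (simp add: powr_diff powr_minus_divide)
    also have "\<dots> \<le> ((1 + a) / 2) powr - \<beta>' / R"
      using m a exps R by (intro frac_le powr_mono2') auto
    also have "\<dots> = 2 powr \<beta>' / R * (1 + a) powr - \<beta>'"
      using a by (simp add: powr_divide powr_minus_divide)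
    finally show ?thesis .
  qed
  finally show "real_of_int (l1_norm (y - z)) powr - \<beta>
      \<le> 4 powr \<beta> * 2 powr \<beta>' / R * ((1 + real_of_int (l1_norm y)) powr - \<beta>' * (1 + real_of_int (l1_norm z)) powr - \<beta>')"
    by (simp add: a_def b_def mult_left_mono mult_right_mono mult.assoc)
qed

context ilrfpp
begin

text \<open>
  The cutoff \<open>R\<close> is needed because near the origin \<open>\<parallel>y\<parallel> powr A\<close> is small and light edges that reach
  beyond it need not be rare.
\<close>

definition light_jump_event :: "real \<Rightarrow> real \<Rightarrow> real \<Rightarrow> 'a set" where
  "light_jump_event K A R = {w \<in> space M. \<exists>y z. max R (l1_norm y) powr A < l1_norm z \<and> passage_time V \<omega> \<alpha> w y z \<le> K}"

text \<open>
  The exponent \<open>A\<close> is chosen from \<open>\<alpha>\<close>, \<open>\<gamma>\<close>, \<open>\<theta>\<close> and \<open>d\<close> alone, before \<open>\<epsilon>\<close>; small probability is then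
  obtained by raising \<open>R\<close>, since the sum of the edge bounds over all pairs \<open>(y, z)\<close> is at most
  \<open>D S\<^sup>2 / R\<close>, where \<open>S\<close> is the lattice sum of \<open>(1 + \<parallel>z\<parallel>) powr - \<beta>'\<close>.
\<close>

lemma light_jump_event_unlikely:
  assumes "\<alpha> * \<gamma> > real CARD('d)" "\<alpha> * \<theta> > real CARD('d)" "K > 0"
  obtains A where "2 \<le> A"
    and "\<And>\<epsilon>. 0 < \<epsilon> \<Longrightarrow> \<exists>R\<ge>3. light_jump_event K A R \<in> sets M \<and> measure M (light_jump_event K A R) \<le> \<epsilon>"
proof -
  obtain p where p: "real CARD('d) / \<alpha> < p" "p < min \<gamma> \<theta>"
    using dense[of "real CARD('d) / \<alpha>" "min \<gamma> \<theta>"] assms parameters_pos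
    by (auto simp: divide_less_eq mult.commute)
  have "0 < real CARD('d) / \<alpha>" using parameters_pos by simp
  then have p': "0 < p" "p < \<gamma>" "p < \<theta>" using p by linarith+
  define \<beta> where "\<beta> = \<alpha> * p"
  have "real CARD('d) < \<beta>" using p parameters_pos by (simp add: \<beta>_def divide_less_eq mult.commute)
  then obtain \<beta>' where \<beta>': "real CARD('d) < \<beta>'" "\<beta>' < \<beta>" using dense by blast
  then have \<beta>'_pos: "0 < \<beta>'" using of_nat_0_le_iff[of "CARD('d)"] by linarith
  \<comment> \<open>The value \<open>2\<close> makes a jump at least double the distance from the origin, since \<open>R \<ge> 2\<close>.\<close>
  define A where "A = max 2 ((\<beta>' + 1) / (\<beta> - \<beta>'))"
  have "2 \<le> A" "(\<beta>' + 1) / (\<beta> - \<beta>') \<le> A" by (simp_all add: A_def)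
  then have A: "2 \<le> A" "\<beta>' + 1 \<le> A * (\<beta> - \<beta>')"
    using \<beta>' by (simp_all add: pos_divide_le_eq)
  obtain B where B: "0 \<le> B"
    "\<And>y z. y \<noteq> z \<Longrightarrow> emeasure M {w \<in> space M. passage_time V \<omega> \<alpha> w y z \<le> K}
        \<le> ennreal (B * real_of_int (l1_norm (y - z)) powr - \<beta>)"
    using prob_light_edge_le[OF p' \<open>K > 0\<close>] unfolding \<beta>_def by blast
  define g where "g z = (1 + real_of_int (l1_norm z)) powr - \<beta>'" for z :: "'d vertex"
  have g: "0 \<le> g z" for z by (simp add: g_def)
  have "(\<integral>\<^sup>+z. ennreal (g z) \<partial>count_space UNIV) < \<infinity>"
    unfolding g_def by (rule nn_integral_l1_norm_powr_finite[OF \<beta>'(1)])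
  then obtain S where S: "0 \<le> S" "(\<integral>\<^sup>+z. ennreal (g z) \<partial>count_space UNIV) = ennreal S"
    by (cases "\<integral>\<^sup>+z. ennreal (g z) \<partial>count_space UNIV") auto
  define D where "D = B * (4 powr \<beta> * 2 powr \<beta>')"
  have D: "0 \<le> D" using B by (simp add: D_def)
  have bound: "light_jump_event K A R \<in> sets M \<and> measure M (light_jump_event K A R) \<le> D * S\<^sup>2 / R"
    if R: "3 \<le> R" for R
  proof
    define J where "J i = {w \<in> space M. max R (l1_norm (fst i)) powr A < l1_norm (snd i)
      \<and> passage_time V \<omega> \<alpha> w (fst i) (snd i) \<le> K}" for i
    have J_eq: "light_jump_event K A R = (\<Union>i. J i)"
      by (rule set_eqI) (simp add: light_jump_event_def J_def split_paired_Ex)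
    have J_sets: "J i \<in> sets M" for i
    proof (cases "max R (l1_norm (fst i)) powr A < l1_norm (snd i)")
      case True
      note [measurable] = passage_time_measurable[OF distance_powr_le_product(1)[OF \<beta>'_pos \<beta>'(2) A _ True]]
      show ?thesis using R True by (simp add: J_def)
    qed (simp add: J_def)
    then show meas: "light_jump_event K A R \<in> sets M" unfolding J_eq by (intro sets.countable_UN') auto
    have J_le: "emeasure M (J i) \<le> ennreal (D / R * g (fst i)) * ennreal (g (snd i))" for i
    proof (cases "max R (l1_norm (fst i)) powr A < l1_norm (snd i)")
      case True
      have "2 \<le> R" using R by simp
      note * = distance_powr_le_product[OF \<beta>'_pos \<beta>'(2) A \<open>2 \<le> R\<close> True]
      have "emeasure M (J i) \<le> ennreal (B * real_of_int (l1_norm (fst i - snd i)) powr - \<beta>)"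
        using B(2)[OF *(1)] True by (simp add: J_def)
      also have "\<dots> \<le> ennreal (B * (4 powr \<beta> * 2 powr \<beta>' / R * (g (fst i) * g (snd i))))"
        unfolding g_def using *(2) B(1) by (intro ennreal_leI mult_left_mono)
      also have "\<dots> = ennreal (D / R * g (fst i)) * ennreal (g (snd i))"
        using B(1) R g by (simp add: ennreal_mult[symmetric] D_def mult_ac)
      finally show ?thesis .
    qed (simp add: J_def)
    have "emeasure M (light_jump_event K A R) \<le> (\<integral>\<^sup>+i. emeasure M (J i) \<partial>count_space UNIV)"
      unfolding J_eq by (intro emeasure_UN_le_nn_integral_count_space J_sets)
    also have "\<dots> \<le> (\<integral>\<^sup>+i. ennreal (D / R * g (fst i)) * ennreal (g (snd i)) \<partial>count_space UNIV)"
      by (intro nn_integral_mono J_le)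
    also have "\<dots> = (\<integral>\<^sup>+y. \<integral>\<^sup>+z. ennreal (D / R * g y) * ennreal (g z) \<partial>count_space UNIV \<partial>count_space UNIV)"
      by (subst nn_integral_fst_count_space[symmetric]) simp
    also have "\<dots> = (\<integral>\<^sup>+y. ennreal (D / R * g y) * ennreal S \<partial>count_space UNIV)"
      by (simp add: nn_integral_cmult S)
    also have "\<dots> = (\<integral>\<^sup>+y. ennreal (D / R * S) * ennreal (g y) \<partial>count_space UNIV)"
      using D R S g by (intro nn_integral_cong) (simp add: ennreal_mult[symmetric] mult_ac)
    also have "\<dots> = ennreal (D * S\<^sup>2 / R)"
      using D R S by (simp add: nn_integral_cmult ennreal_mult[symmetric] power2_eq_square mult.assoc)
    finally show "measure M (light_jump_event K A R) \<le> D * S\<^sup>2 / R"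
      using D R S by (simp add: emeasure_eq_measure)
  qed
  show thesis
  proof (rule that[OF A(1)])
    fix \<epsilon> :: real assume \<epsilon>: "0 < \<epsilon>"
    define R where "R = max 3 (D * S\<^sup>2 / \<epsilon>)"
    have "D * S\<^sup>2 / \<epsilon> \<le> R" "3 \<le> R" by (simp_all add: R_def)
    then have "D * S\<^sup>2 / R \<le> \<epsilon>" using \<epsilon> by (simp add: field_simps)
    then show "\<exists>R\<ge>3. light_jump_event K A R \<in> sets M \<and> measure M (light_jump_event K A R) \<le> \<epsilon>"
      using bound[of R] \<open>3 \<le> R\<close> by force
  qed
qed

end

section \<open>Doubly exponential confinement of light paths\<close>

context ilrfpp
begin

lemma passage_time_nonneg:
  assumes "\<And>y. 0 < V y w" "\<And>y z. y \<noteq> z \<Longrightarrow> 0 < \<omega> {y, z} w" "y \<noteq> z"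
  shows "0 \<le> passage_time V \<omega> \<alpha> w y z"
  unfolding passage_time_def using assms by (simp add: less_imp_le)

text \<open>
  Each edge of the path is light on its own because the other passage times are nonnegative. So
  one more edge raises the bound on the distance from the origin at most to the power \<open>A\<close>.
\<close>

lemma light_path_confined:
  assumes pos: "\<And>y. 0 < V y w" "\<And>y z. y \<noteq> z \<Longrightarrow> 0 < \<omega> {y, z} w"
    and w: "w \<in> space M" "w \<notin> light_jump_event K A R" and A: "1 \<le> A" and R: "1 \<le> R"
    and \<pi>: "\<pi> \<in> light_paths V \<omega> \<alpha> x n K w" and i: "i \<le> num_edges \<pi>"
  shows "real_of_int (l1_norm (\<pi> ! i)) \<le> R powr (A ^ i)"
  using i
proof (induction i)
  case 0
  have "\<pi> ! 0 = 0"
    using \<pi> by (auto simp: light_paths_def is_path_def hd_conv_nth)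
  then show ?case using R by (simp add: l1_norm_def)
next
  case (Suc i)
  have path: "distinct \<pi>" "path_weight V \<omega> \<alpha> w \<pi> \<le> K"
    using \<pi> by (auto simp: light_paths_def is_path_def)
  have ne: "\<pi> ! j \<noteq> \<pi> ! Suc j" if "j < num_edges \<pi>" for j
    using that path by (auto simp: num_edges_def nth_eq_iff_index_eq)
  have "passage_time V \<omega> \<alpha> w (\<pi> ! i) (\<pi> ! Suc i) \<le> path_weight V \<omega> \<alpha> w \<pi>"
    unfolding path_weight_def
    using Suc.prems ne passage_time_nonneg[OF pos]
    by (intro member_le_sum[where f = "\<lambda>i. passage_time V \<omega> \<alpha> w (\<pi> ! i) (\<pi> ! Suc i)"]) auto
  with path have "passage_time V \<omega> \<alpha> w (\<pi> ! i) (\<pi> ! Suc i) \<le> K" by linarith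
  then have "real_of_int (l1_norm (\<pi> ! Suc i)) \<le> max R (l1_norm (\<pi> ! i)) powr A"
    using w by (force simp: light_jump_event_def not_less)
  also have "\<dots> \<le> (R powr (A ^ i)) powr A"
  proof (intro powr_mono2)
    have "R powr 1 \<le> R powr (A ^ i)" using A R by (intro powr_mono one_le_power)
    then show "max R (l1_norm (\<pi> ! i)) \<le> R powr (A ^ i)" using Suc R by simp
  qed (use A R in auto)
  finally show ?case by (simp add: powr_powr mult.commute)
qed

end

section \<open>Lower bound on the number of edges\<close>

text \<open>
  The distance grows linearly in \<open>n\<close>. The weaker square root absorbs the constants, including the
  rounding towards \<open>0\<close> at negative coordinates, and after two logarithms it costs only an
  additive \<open>ln 2\<close>.
\<close>

lemma sqrt_le_l1_norm_ceiling_vec: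
  fixes x :: "real ^ 'd::finite"
  assumes "x \<noteq> 0"
  shows "\<forall>\<^sub>F n in sequentially. sqrt (real n) \<le> real_of_int (l1_norm (ceiling_vec (real n *\<^sub>R x)))"
proof -
  obtain i where i: "x $ i \<noteq> 0" using assms by (auto simp: vec_eq_iff)
  then have "\<forall>\<^sub>F n in sequentially. sqrt (real n) \<le> real n * \<bar>x $ i\<bar> - 1"
    by real_asymp
  then show ?thesis
  proof eventually_elim
    case (elim n)
    have "\<bar>\<lceil>real n * x $ i\<rceil>\<bar> \<le> l1_norm (ceiling_vec (real n *\<^sub>R x))"
      using abs_component_le_l1_norm[of "ceiling_vec (real n *\<^sub>R x)" i] by (simp add: ceiling_vec_def)
    moreover have "real n * \<bar>x $ i\<bar> - 1 \<le> real_of_int \<bar>\<lceil>real n * x $ i\<rceil>\<bar>"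
    proof -
      have "real n * \<bar>x $ i\<bar> = \<bar>real n * x $ i\<bar>" by (simp add: abs_mult)
      then show ?thesis by linarith
    qed
    ultimately show ?case using elim by linarith
  qed
qed

text \<open>
  Without a light jump, a light path with \<open>k\<close> edges satisfies \<open>sqrt n \<le> R powr (A ^ k)\<close>. Two
  logarithms turn this into \<open>ln (ln n) / ln A \<le> k + ln (2 ln R) / ln A\<close>.
\<close>

lemma (in ilrfpp) few_edges_unlikely:
  assumes A: "2 \<le> A" and R: "3 \<le> R" and "x \<noteq> 0" and meas: "light_jump_event K A R \<in> sets M"
  shows "\<exists>C. \<forall>\<^sub>F n in sequentially.
    measure M {w \<in> space M. \<exists>\<pi>\<in>light_paths V \<omega> \<alpha> x n K w. real (num_edges \<pi>) \<le> ln (ln (real n)) / ln A - C}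
      \<le> measure M (light_jump_event K A R)"
proof
  \<comment> \<open>The summand \<open>1\<close> makes the inequality strict.\<close>
  define C where "C = ln (2 * ln R) / ln A + 1"
  have "\<forall>\<^sub>F n in sequentially. (3::nat) \<le> n" by (rule eventually_ge_at_top)
  with sqrt_le_l1_norm_ceiling_vec[OF \<open>x \<noteq> 0\<close>]
  show "\<forall>\<^sub>F n in sequentially.
    measure M {w \<in> space M. \<exists>\<pi>\<in>light_paths V \<omega> \<alpha> x n K w. real (num_edges \<pi>) \<le> ln (ln (real n)) / ln A - C}
      \<le> measure M (light_jump_event K A R)"
  proof eventually_elim
    case (elim n)
    have A': "0 < ln A" and R': "0 < ln R" using A R by auto
    have n: "0 < ln (real n)" using elim by auto
    have many: "ln (ln (real n)) / ln A - C < real (num_edges \<pi>)"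
      if "\<And>y. 0 < V y w" "\<And>y z. y \<noteq> z \<Longrightarrow> 0 < \<omega> {y, z} w" "w \<in> space M" "w \<notin> light_jump_event K A R"
        and \<pi>: "\<pi> \<in> light_paths V \<omega> \<alpha> x n K w" for w \<pi>
    proof -
      define k where "k = num_edges \<pi>"
      have "\<pi> ! k = ceiling_vec (real n *\<^sub>R x)"
        using \<pi> by (auto simp: light_paths_def is_path_def k_def num_edges_def last_conv_nth)
      then have "sqrt (real n) \<le> R powr (A ^ k)"
        using light_path_confined[OF that(1-4) _ _ \<pi>, of k] elim A R by (simp add: k_def)
      then have "ln (sqrt (real n)) \<le> ln (R powr (A ^ k))"
        using elim R by (subst ln_le_cancel_iff) auto
      then have "ln (real n) \<le> 2 * ln R * A ^ k"
        using R elim by (simp add: ln_sqrt ln_powr mult_ac)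
      then have "ln (ln (real n)) \<le> ln (2 * ln R * A ^ k)"
        using n A R' by (subst ln_le_cancel_iff) auto
      also have "\<dots> = ln (2 * ln R) + real k * ln A"
        using A R' by (simp add: ln_mult ln_realpow)
      finally have "ln (ln (real n)) / ln A \<le> ln (2 * ln R) / ln A + real k"
        using A' by (simp add: field_simps)
      then show ?thesis by (simp add: C_def k_def)
    qed
    show ?case
    proof (rule finite_measure_mono_AE[OF _ meas])
      show "AE w in M. w \<in> {w \<in> space M. \<exists>\<pi>\<in>light_paths V \<omega> \<alpha> x n K w.
          real (num_edges \<pi>) \<le> ln (ln (real n)) / ln A - C} \<longrightarrow> w \<in> light_jump_event K A R"
        using AE_all_weights_pos
      proof eventually_elim
        case (elim w)
        show ?case
        proof (intro impI, rule ccontr)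
          assume "w \<in> {w \<in> space M. \<exists>\<pi>\<in>light_paths V \<omega> \<alpha> x n K w.
            real (num_edges \<pi>) \<le> ln (ln (real n)) / ln A - C}" and out: "w \<notin> light_jump_event K A R"
          then obtain \<pi> where "w \<in> space M" "\<pi> \<in> light_paths V \<omega> \<alpha> x n K w"
            "real (num_edges \<pi>) \<le> ln (ln (real n)) / ln A - C" by blast
          with many[of w \<pi>] elim out show False by simp
        qed
      qed
    qed
  qed
qed

theorem theorem2p7:
  fixes M :: "'a measure"
    and V :: "'d::finite vertex \<Rightarrow> 'a \<Rightarrow> real"
    and \<omega> :: "'d vertex set \<Rightarrow> 'a \<Rightarrow> real"
    and \<mu> \<nu> :: "real measure"
    and \<alpha> \<gamma> \<theta> \<zeta> K :: real
    and x :: "real ^ 'd"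
  assumes "ilrfpp M V \<omega> \<mu> \<nu> \<alpha> \<gamma> \<theta> \<zeta>"
    and "\<alpha> * \<gamma> > real CARD('d)"
    and "\<alpha> * \<theta> > real CARD('d)"
    and "infnorm x \<le> 1"
    and "x \<noteq> 0"
    and "K > 0"
  shows "\<exists>a\<^sub>0 > (1::real).
    (\<forall>\<epsilon> > (0::real). \<exists>C::real.
      limsup (\<lambda>n. ereal (measure M {w \<in> space M. \<exists>\<pi> \<in> light_paths V \<omega> \<alpha> x n K w.
        real (num_edges \<pi>) \<le> ln (ln (real n)) / ln a\<^sub>0 - C})) \<le> ereal \<epsilon>) \<and>
    (\<forall>c < 1 / ln a\<^sub>0.
      (\<lambda>n. measure M {w \<in> space M. \<exists>\<pi> \<in> light_paths V \<omega> \<alpha> x n K w.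
        real (num_edges \<pi>) \<le> c * ln (ln (real n))}) \<longlonglongrightarrow> 0)"
proof -
  interpret ilrfpp M V \<omega> \<mu> \<nu> \<alpha> \<gamma> \<theta> \<zeta> by fact
  let ?E = "\<lambda>n r. {w \<in> space M. \<exists>\<pi> \<in> light_paths V \<omega> \<alpha> x n K w. real (num_edges \<pi>) \<le> r}"
  obtain A where A: "2 \<le> A"
    and unlikely: "\<And>\<epsilon>. 0 < \<epsilon> \<Longrightarrow>
      \<exists>R\<ge>3. light_jump_event K A R \<in> sets M \<and> measure M (light_jump_event K A R) \<le> \<epsilon>"
    using light_jump_event_unlikely assms by blast
  have few: "\<exists>C. \<forall>\<^sub>F n in sequentially. measure M (?E n (ln (ln (real n)) / ln A - C)) \<le> \<epsilon>"
    if \<epsilon>: "0 < \<epsilon>" for \<epsilon>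
  proof -
    obtain R where R: "3 \<le> R" "light_jump_event K A R \<in> sets M" "measure M (light_jump_event K A R) \<le> \<epsilon>"
      using unlikely[OF \<epsilon>] by blast
    obtain C where "\<forall>\<^sub>F n in sequentially.
        measure M (?E n (ln (ln (real n)) / ln A - C)) \<le> measure M (light_jump_event K A R)"
      using few_edges_unlikely[OF A R(1) \<open>x \<noteq> 0\<close> R(2)] by blast
    then have "\<forall>\<^sub>F n in sequentially. measure M (?E n (ln (ln (real n)) / ln A - C)) \<le> \<epsilon>"
      by eventually_elim (use R(3) in linarith)
    then show ?thesis by blast
  qed
  have "\<exists>C. limsup (\<lambda>n. ereal (measure M (?E n (ln (ln (real n)) / ln A - C)))) \<le> ereal \<epsilon>"
    if \<epsilon>: "0 < \<epsilon>" for \<epsilon>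
  proof -
    obtain C where "\<forall>\<^sub>F n in sequentially. measure M (?E n (ln (ln (real n)) / ln A - C)) \<le> \<epsilon>"
      using few[OF \<epsilon>] by blast
    then have "limsup (\<lambda>n. ereal (measure M (?E n (ln (ln (real n)) / ln A - C)))) \<le> ereal \<epsilon>"
      by (intro Limsup_bounded) (auto elim: eventually_mono)
    then show ?thesis by blast
  qed
  moreover have "(\<lambda>n. measure M (?E n (c * ln (ln (real n))))) \<longlonglongrightarrow> 0" if c: "c < 1 / ln A" for c
  proof (rule order_tendstoI)
    fix e :: real assume "0 < e"
    then obtain C where C: "\<forall>\<^sub>F n in sequentially. measure M (?E n (ln (ln (real n)) / ln A - C)) \<le> e / 2"
      using few[of "e / 2"] by auto
    \<comment> \<open>The gap between \<open>c\<close> and \<open>1 / ln A\<close>, multiplied by \<open>ln (ln n)\<close>, eventually exceeds any constant \<open>C\<close>.\<close>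
    define \<delta> where "\<delta> = 1 / ln A - c"
    have "0 < \<delta>" using c by (simp add: \<delta>_def)
    then have "\<forall>\<^sub>F n in sequentially. C \<le> \<delta> * ln (ln (real n))" by real_asymp
    with C show "\<forall>\<^sub>F n in sequentially. measure M (?E n (c * ln (ln (real n)))) < e"
    proof eventually_elim
      case (elim n)
      have "c * ln (ln (real n)) \<le> ln (ln (real n)) / ln A - C"
        using elim by (simp add: \<delta>_def left_diff_distrib)
      then have "measure M (?E n (c * ln (ln (real n)))) \<le> measure M (?E n (ln (ln (real n)) / ln A - C))"
        by (intro finite_measure_mono light_path_event_measurable) force
      then show ?case using elim \<open>0 < e\<close> by linarith
    qed
  qed (use measure_nonneg less_le_trans in \<open>blast intro: always_eventually\<close>)
  ultimately show ?thesis
    using A by (intro exI[of _ A]) auto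
qed

end
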